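(* Let $\{X_{n,k}, \, 1 \leqslant k \leqslant n, n \geqslant 1\}$ be an array of random variables satisfying $\mathbb{E}|X_{n,k}| < \infty$ for each $1 \leqslant k \leqslant n$ and all $n \geqslant 1$. Suppose that for some $q > 2$ and some sequences $\{\beta_{n}\}$, $\{\xi_{n}\}$ of positive numbers, $$\mathbb{E}\left|\sum_{k=1}^{n}\left[g_{t}(X_{n,k}) - \mathbb{E}\, g_{t}(X_{n,k})\right]\right|^{q} \leqslant \beta_{n}\sum_{k=1}^{n}\mathbb{E}\,|g_{t}(X_{n,k})|^{q} + \xi_{n}\left[\sum_{k=1}^{n}\mathbb{E}\,|g_{t}(X_{n,k})|^{2}\right]^{q/2}\quad\text{for all } n \geqslant 1 \text{ and } t > 0.$$ If $\{b_{n}\}$, $\{c_{n}\}$ are real sequences of positive numbers such that (a) $\sum_{n=1}^{\infty}\sum_{k=1}^{n}\beta_{n}c_{n}b_{n}^{-q}\int_{0}^{b_{n}^{q}}\mathbb{P}\{|X_{n,k}|^{q} > t\}\,\mathrm{d}t < \infty$, (b) $\sum_{n=1}^{\infty}(\xi_{n}c_{n}/b_{n})\int_{0}^{b_{n}^{1-q}}\left(\sum_{k=1}^{n}\int_{0}^{t^{2/(1-q)}}\mathbb{P}\{X_{n,k}^{2} > s\}\,\mathrm{d}s\right)^{q/2}\mathrm{d}t < \infty$, (c) $\sum_{n=1}^{\infty}\xi_{n}c_{n}b_{n}^{-q}\left(\sum_{k=1}^{n}\int_{0}^{b_{n}^{2}}\mathbb{P}\{X_{n,k}^{2} > t\}\,\mathrm{d}t\right)^{q/2}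 < \infty$, (d) $\sum_{n=1}^{\infty}\sum_{k=1}^{n}c_{n}\,\mathbb{E}\left[|X_{n,k}| I_{\{|X_{n,k}| > b_{n}\}}\right]/b_{n} < \infty$, (e) $\sum_{n=1}^{\infty}\sum_{k=1}^{n}(\beta_{n}c_{n}/b_{n})\int_{b_{n}}^{\infty}\mathbb{P}\{|X_{n,k}| > t\}\,\mathrm{d}t < \infty$, then $$\sum_{n=1}^{\infty}c_{n}\,\mathbb{E}\left[\frac{\left|\sum_{k=1}^{n}(X_{n,k} - \mathbb{E}\,X_{n,k})\right|}{b_{n}} - \varepsilon\right]_{+} < \infty$$ for all $\varepsilon > 0$.
   Context: Notation: $x_{+} = \max(x,0)$. $I_{A}$ is the indicator random variable of the event $A$. For $t>0$, $g_{t}(x) = \max(\min(x,t),-t)$ is truncation at level $t$. *)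

theory Defs
  imports "HOL-Probability.Probability"
begin

definition trunc :: "real \<Rightarrow> real \<Rightarrow> real" where
  "trunc t x = max (min x t) (- t)"

definition pos_part :: "real \<Rightarrow> real" where
  "pos_part x = max x 0"

end

theory Submission
  imports Defs
begin

text \<open>Truncate at level \<open>b n\<close>. The truncation error is at most \<open>\<bar>X\<bar>\<close> on the event
  \<open>\<bar>X\<bar> > b n\<close>, and condition (d) controls it. For the truncated sum \<open>Y\<close>, the inequality
  \<open>pos_part (y - \<epsilon>) \<le> \<epsilon> powr (1 - q) * y powr q\<close> with \<open>y = \<bar>Y\<bar> / b n\<close> reduces the claim to the moment
  hypothesis at \<open>t = b n\<close>. The layer-cake formula identifies the moments of order \<open>q\<close> and \<open>2\<close> occurring
  there with the tail integrals of (a) and (c).\<close>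

context prob_space begin

text \<open>Layer cake: \<open>min (f \<omega>) T\<close> is the length of the set of levels
  \<open>t\<close> in \<open>{0..T}\<close> lying strictly below \<open>f \<omega>\<close>.
  Integrating this over \<open>M\<close> and exchanging the two integrals turns the inner one into a
  tail probability.\<close>

lemma nn_integral_min_eq_tail:
  assumes [measurable]: "f \<in> borel_measurable M" and nn: "\<And>\<omega>. 0 \<le> f \<omega>" and T: "0 \<le> T"
  shows "(\<integral>\<^sup>+\<omega>. ennreal (min (f \<omega>) T) \<partial>M)
    = (\<integral>\<^sup>+t\<in>{0..T}. ennreal \<P>(\<omega> in M. f \<omega> > t) \<partial>lborel)"
proof -
  interpret P: pair_sigma_finite M lborel ..
  have "ennreal (min (f \<omega>) T)
      = (\<integral>\<^sup>+t. indicator {0..T} t * indicator {\<omega>\<in>space M. t < f \<omega>} \<omega> \<partial>lborel)"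
    if "\<omega> \<in> space M" for \<omega>
  proof -
    \<comment> \<open>The strict tail \<open>t < f \<omega>\<close> cuts out a half-open interval
      when \<open>f \<omega> \<le> T\<close> and all of \<open>{0..T}\<close> otherwise; in both
      cases the length is \<open>min (f \<omega>) T\<close>.\<close>
    have "(\<lambda>t. indicator {0..T} t * indicator {\<omega>\<in>space M. t < f \<omega>} \<omega> :: ennreal)
      = indicator (if f \<omega> \<le> T then {0..<f \<omega>} else {0..T})"
      using that by (auto simp: fun_eq_iff indicator_def)
    then show ?thesis
      using nn[of \<omega>] T by (auto simp: min_def)
  qed
  then have "(\<integral>\<^sup>+\<omega>. ennreal (min (f \<omega>) T) \<partial>M)
      = (\<integral>\<^sup>+\<omega>. \<integral>\<^sup>+t. indicator {0..T} t * indicator {\<omega>\<in>space M. t < f \<omega>} \<omega> \<partial>lborel \<partial>M)"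
    by (intro nn_integral_cong)
  also have "\<dots> = (\<integral>\<^sup>+t. \<integral>\<^sup>+\<omega>. indicator {0..T} t * indicator {\<omega>\<in>space M. t < f \<omega>} \<omega> \<partial>M \<partial>lborel)"
    by (intro P.Fubini'[symmetric]) measurable
  also have "\<dots> = (\<integral>\<^sup>+t\<in>{0..T}. ennreal \<P>(\<omega> in M. f \<omega> > t) \<partial>lborel)"
    by (intro nn_integral_cong) (simp add: nn_integral_cmult emeasure_eq_measure mult.commute)
  finally show ?thesis .
qed

text \<open>Capping at \<open>T\<close> makes the variable bounded, hence integrable, so the
  layer-cake identity passes to the expectation. Both forms are wanted: condition (a) uses a
  nonnegative integral, whereas (c) takes a real power of a sum of Bochner integrals.\<close>

lemma expectation_min_eq_tail:
  assumes [measurable]: "f \<in> borel_measurable M" and nn: "\<And>\<omega>. 0 \<le> f \<omega>" and T: "0 \<le> T"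
  shows "ennreal (expectation (\<lambda>\<omega>. min (f \<omega>) T))
      = (\<integral>\<^sup>+t\<in>{0..T}. ennreal \<P>(\<omega> in M. f \<omega> > t) \<partial>lborel)"
    and "expectation (\<lambda>\<omega>. min (f \<omega>) T) = (LINT t:{0..T}|lborel. \<P>(\<omega> in M. f \<omega> > t))"
proof -
  have "integrable M (\<lambda>\<omega>. min (f \<omega>) T)"
    using nn T by (intro integrable_const_bound[where B = T]) auto
  then show eq: "ennreal (expectation (\<lambda>\<omega>. min (f \<omega>) T))
      = (\<integral>\<^sup>+t\<in>{0..T}. ennreal \<P>(\<omega> in M. f \<omega> > t) \<partial>lborel)"
    using nn T by (subst nn_integral_eq_integral[symmetric]) (auto intro: nn_integral_min_eq_tail)
  have [measurable]: "(\<lambda>t. \<P>(\<omega> in M. f \<omega> > t)) \<in> borel_measurable lborel"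
    by measurable
  have "(LINT t:{0..T}|lborel. \<P>(\<omega> in M. f \<omega> > t))
      = enn2real (\<integral>\<^sup>+t\<in>{0..T}. ennreal \<P>(\<omega> in M. f \<omega> > t) \<partial>lborel)"
    unfolding set_lebesgue_integral_def
    by (subst integral_eq_nn_integral)
      (auto intro!: arg_cong[where f = enn2real] nn_integral_cong simp: indicator_def)
  then show "expectation (\<lambda>\<omega>. min (f \<omega>) T) = (LINT t:{0..T}|lborel. \<P>(\<omega> in M. f \<omega> > t))"
    using nn T by (simp add: eq[symmetric])
qed

text \<open>The estimate for a single row: a moment of order \<open>q\<close> of the centred
  truncated sum plus the tail first moments. The factor 2 arises because centring makes each
  truncation error count once itself and once through its mean.\<close>

lemma expectation_pos_part_sum_le:
  fixes Z :: "'i \<Rightarrow> 'a \<Rightarrow> real"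
  assumes I: "finite I" and Z: "\<And>i. i \<in> I \<Longrightarrow> integrable M (Z i)"
    and u: "0 < u" and \<epsilon>: "0 < \<epsilon>" and q: "1 \<le> q"
  shows "(\<integral>\<^sup>+\<omega>. ennreal (pos_part (\<bar>\<Sum>i\<in>I. Z i \<omega> - expectation (Z i)\<bar> / u - \<epsilon>)) \<partial>M)
    \<le> ennreal (\<epsilon> powr (1 - q) * u powr (- q) *
          expectation (\<lambda>\<omega>. \<bar>\<Sum>i\<in>I. trunc u (Z i \<omega>) - expectation (\<lambda>\<omega>. trunc u (Z i \<omega>))\<bar> powr q))
      + 2 * (\<Sum>i\<in>I. ennreal (1 / u) *
          (\<integral>\<^sup>+\<omega>. ennreal (\<bar>Z i \<omega>\<bar> * indicator {\<omega>. \<bar>Z i \<omega>\<bar> > u} \<omega>) \<partial>M))"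
proof -
  define Y where "Y \<omega> = (\<Sum>i\<in>I. trunc u (Z i \<omega>) - expectation (\<lambda>\<omega>. trunc u (Z i \<omega>)))" for \<omega>
  define W where "W i \<omega> = \<bar>Z i \<omega>\<bar> * indicator {\<omega>. \<bar>Z i \<omega>\<bar> > u} \<omega>" for i \<omega>
  define K where "K = \<epsilon> powr (1 - q) * u powr (- q)"
  have Zm[measurable]: "Z i \<in> borel_measurable M" if "i \<in> I" for i
    using Z[OF that] by simp
  have tm[measurable]: "trunc u \<in> borel_measurable borel"
    unfolding trunc_def[abs_def] by measurable
  have tb: "\<bar>trunc u x\<bar> \<le> u" for x
    using u by (auto simp: trunc_def)
  have ti: "integrable M (\<lambda>\<omega>. trunc u (Z i \<omega>))" if "i \<in> I" for i
    using tb that by (intro integrable_const_bound[where B = u]) auto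
  have Wm[measurable]: "W i \<in> borel_measurable M" if "i \<in> I" for i
    using that unfolding W_def[abs_def] indicator_def by measurable
  have Wi: "integrable M (W i)" if "i \<in> I" for i
    using that by (intro Bochner_Integration.integrable_bound[OF Z[OF that]])
      (auto simp: W_def indicator_def)
  have W0: "0 \<le> W i \<omega>" for i \<omega>
    by (simp add: W_def)
  \<comment> \<open>The error vanishes where \<open>\<bar>Z i \<omega>\<bar> \<le> u\<close> and
    equals \<open>\<bar>Z i \<omega>\<bar> - u\<close> elsewhere.\<close>
  have R: "\<bar>Z i \<omega> - trunc u (Z i \<omega>)\<bar> \<le> W i \<omega>" for i \<omega>
    using u by (auto simp: trunc_def W_def indicator_def)
  \<comment> \<open>This crude bound only serves to make
    \<open>\<bar>Y \<omega>\<bar> powr q\<close> integrable: each truncated term and its mean are at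
    most \<open>u\<close> in absolute value.\<close>
  have Yb: "\<bar>Y \<omega>\<bar> \<le> (\<Sum>i\<in>I. 2 * u)" for \<omega>
    unfolding Y_def
  proof (intro order_trans[OF sum_abs] sum_mono)
    fix i assume i: "i \<in> I"
    have "\<bar>expectation (\<lambda>\<omega>. trunc u (Z i \<omega>))\<bar> \<le> expectation (\<lambda>\<omega>. u)"
      using tb ti[OF i] by (intro order_trans[OF integral_abs_bound] integral_mono) auto
    then show "\<bar>trunc u (Z i \<omega>) - expectation (\<lambda>\<omega>. trunc u (Z i \<omega>))\<bar> \<le> 2 * u"
      using tb[of "Z i \<omega>"] by (simp add: prob_space)
  qed
  have [measurable]: "Y \<in> borel_measurable M"
    unfolding Y_def[abs_def] by measurable
  have Yi: "integrable M (\<lambda>\<omega>. \<bar>Y \<omega>\<bar> powr q)"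
    using Yb q by (intro integrable_const_bound[where B = "(\<Sum>i\<in>I. 2 * u) powr q"]) 
      (auto intro!: powr_mono2)
  have S: "\<bar>\<Sum>i\<in>I. Z i \<omega> - expectation (Z i)\<bar> \<le> \<bar>Y \<omega>\<bar> + (\<Sum>i\<in>I. W i \<omega> + expectation (W i))" for \<omega>
  proof -
    have "(\<Sum>i\<in>I. Z i \<omega> - expectation (Z i)) - Y \<omega>
        = (\<Sum>i\<in>I. (Z i \<omega> - trunc u (Z i \<omega>)) - expectation (\<lambda>\<omega>. Z i \<omega> - trunc u (Z i \<omega>)))"
      unfolding Y_def sum_subtractf[symmetric] by (intro sum.cong) (simp_all add: Z ti)
    also have "\<bar>\<dots>\<bar> \<le> (\<Sum>i\<in>I. W i \<omega> + expectation (W i))"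
    proof (intro order_trans[OF sum_abs] sum_mono)
      fix i assume i: "i \<in> I"
      have "\<bar>expectation (\<lambda>\<omega>. Z i \<omega> - trunc u (Z i \<omega>))\<bar> \<le> expectation (W i)"
        using R i by (intro order_trans[OF integral_abs_bound] integral_mono)
          (auto simp: Z ti Wi)
      then show "\<bar>Z i \<omega> - trunc u (Z i \<omega>) - expectation (\<lambda>\<omega>. Z i \<omega> - trunc u (Z i \<omega>))\<bar>
          \<le> W i \<omega> + expectation (W i)"
        using R[of i \<omega>] by linarith
    qed
    finally show ?thesis by linarith
  qed
  \<comment> \<open>For \<open>y > \<epsilon>\<close> write
    \<open>y = y powr (1 - q) * y powr q\<close>; the exponent \<open>1 - q\<close> is not positive,
    so the first factor is at most its value at \<open>\<epsilon>\<close>.\<close>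
  have P: "pos_part (y - \<epsilon>) \<le> \<epsilon> powr (1 - q) * y powr q" if "0 \<le> y" for y :: real
  proof (cases "y \<le> \<epsilon>")
    case False
    then have "y powr (1 - q) \<le> \<epsilon> powr (1 - q)"
      using \<epsilon> q by (intro powr_mono2') auto
    then have "y powr (1 - q) * y powr q \<le> \<epsilon> powr (1 - q) * y powr q"
      by (intro mult_right_mono) auto
    then show ?thesis
      using False \<epsilon> by (simp add: pos_part_def powr_add[symmetric])
  qed (simp add: pos_part_def)
  \<comment> \<open>A nonnegative remainder \<open>r\<close> leaves the positive part at full size
    at worst: \<open>pos_part (y + r - \<epsilon>) \<le> pos_part (y - \<epsilon>) + r\<close>. With
    \<open>y = \<bar>Y \<omega>\<bar> / u\<close>, the bound \<open>P\<close> contributes the factor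
    \<open>u powr (- q)\<close> contained in \<open>K\<close>.\<close>
  have pt: "pos_part (\<bar>\<Sum>i\<in>I. Z i \<omega> - expectation (Z i)\<bar> / u - \<epsilon>)
      \<le> K * \<bar>Y \<omega>\<bar> powr q + (\<Sum>i\<in>I. W i \<omega> + expectation (W i)) / u" for \<omega>
  proof -
    have "0 \<le> (\<Sum>i\<in>I. W i \<omega> + expectation (W i)) / u"
      using u W0 by (intro divide_nonneg_pos sum_nonneg add_nonneg_nonneg integral_nonneg) auto
    moreover have "\<bar>\<Sum>i\<in>I. Z i \<omega> - expectation (Z i)\<bar> / u
        \<le> \<bar>Y \<omega>\<bar> / u + (\<Sum>i\<in>I. W i \<omega> + expectation (W i)) / u"
      using divide_right_mono[OF S[of \<omega>], of u] u by (simp add: add_divide_distrib)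
    moreover have "pos_part (\<bar>Y \<omega>\<bar> / u - \<epsilon>) \<le> K * \<bar>Y \<omega>\<bar> powr q"
      using P[of "\<bar>Y \<omega>\<bar> / u"] u by (simp add: K_def powr_divide powr_minus field_simps)
    ultimately show ?thesis
      by (simp add: pos_part_def)
  qed
  have "(\<integral>\<^sup>+\<omega>. ennreal (pos_part (\<bar>\<Sum>i\<in>I. Z i \<omega> - expectation (Z i)\<bar> / u - \<epsilon>)) \<partial>M)
      \<le> (\<integral>\<^sup>+\<omega>. ennreal (K * \<bar>Y \<omega>\<bar> powr q + (\<Sum>i\<in>I. W i \<omega> + expectation (W i)) / u) \<partial>M)"
    by (intro nn_integral_mono ennreal_leI pt)
  also have "\<dots> = ennreal (expectation (\<lambda>\<omega>. K * \<bar>Y \<omega>\<bar> powr q + (\<Sum>i\<in>I. W i \<omega> + expectation (W i)) / u))"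
  proof (intro nn_integral_eq_integral AE_I2)
    show "integrable M (\<lambda>\<omega>. K * \<bar>Y \<omega>\<bar> powr q + (\<Sum>i\<in>I. W i \<omega> + expectation (W i)) / u)"
      by (intro Bochner_Integration.integrable_add integrable_mult_right Yi integrable_divide
        Bochner_Integration.integrable_sum) (auto simp: Wi)
    show "0 \<le> K * \<bar>Y \<omega>\<bar> powr q + (\<Sum>i\<in>I. W i \<omega> + expectation (W i)) / u" for \<omega>
      using u W0 by (intro add_nonneg_nonneg divide_nonneg_pos sum_nonneg integral_nonneg)
        (auto simp: K_def)
  qed
  \<comment> \<open>The random term \<open>W i\<close> and the constant
    \<open>expectation (W i)\<close> have the same mean, which produces the 2.\<close>
  also have "expectation (\<lambda>\<omega>. K * \<bar>Y \<omega>\<bar> powr q + (\<Sum>i\<in>I. W i \<omega> + expectation (W i)) / u)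
      = K * expectation (\<lambda>\<omega>. \<bar>Y \<omega>\<bar> powr q) + 2 * (\<Sum>i\<in>I. 1 / u * expectation (W i))"
    by (simp add: Yi Wi prob_space sum_distrib_left sum_divide_distrib sum.distrib add_divide_distrib)
  also have "ennreal \<dots> = ennreal (K * expectation (\<lambda>\<omega>. \<bar>Y \<omega>\<bar> powr q))
      + 2 * (\<Sum>i\<in>I. ennreal (1 / u) * ennreal (expectation (W i)))"
  proof -
    have W0': "0 \<le> expectation (W i)" for i
      using W0 by simp
    then have "ennreal (2 * (\<Sum>i\<in>I. 1 / u * expectation (W i)))
        = 2 * (\<Sum>i\<in>I. ennreal (1 / u) * ennreal (expectation (W i)))"
      using u by (simp add: ennreal_mult[symmetric] sum_nonneg sum_ennreal ennreal_mult' del: ennreal_mult)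
    then show ?thesis
      using u W0' by (subst ennreal_plus) (auto simp: K_def intro!: sum_nonneg)
  qed
  also have "\<dots> = ennreal (K * expectation (\<lambda>\<omega>. \<bar>Y \<omega>\<bar> powr q))
      + 2 * (\<Sum>i\<in>I. ennreal (1 / u) * (\<integral>\<^sup>+\<omega>. ennreal (W i \<omega>) \<partial>M))"
    using W0 Wi by (simp add: nn_integral_eq_integral)
  finally show ?thesis
    unfolding K_def Y_def W_def .
qed

end

text \<open>An infinite sum in \<open>ennreal\<close> is the supremum of its finite partial sums,
  and multiplication by a constant, even an infinite one, commutes with suprema.\<close>

lemma infsum_cmult_ennreal:
  fixes f :: "'b \<Rightarrow> ennreal"
  shows "(\<Sum>\<^sub>\<infinity>x\<in>S. k * f x) = k * infsum f S"
  by (simp add: nonneg_infsum_complete sum_distrib_left[symmetric] SUP_mult_left_ennreal)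

text \<open>Since \<bar>trunc u x\<bar> is the smaller of \<bar>x\<bar> and \<open>u\<close>,
  monotonicity of the power gives the claim. This puts truncated moments into the capped form that
  the layer-cake formula handles.\<close>

lemma abs_trunc_powr:
  assumes "0 < u" "0 \<le> q"
  shows "\<bar>trunc u x\<bar> powr q = min (\<bar>x\<bar> powr q) (u powr q)"
proof -
  have "\<bar>trunc u x\<bar> = min \<bar>x\<bar> u"
    using assms by (auto simp: trunc_def)
  then show ?thesis
    using assms by (auto simp: min_def powr_mono2 dest: powr_mono2[of q u "\<bar>x\<bar>"] powr_mono2[of q "\<bar>x\<bar>" u])
qed

lemma abs_trunc_power2:
  assumes "0 < u"
  shows "\<bar>trunc u x\<bar>\<^sup>2 = min (x\<^sup>2) (u\<^sup>2)"
  using abs_trunc_powr[OF assms, of 2 x] assms by simp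

theorem theorem2p4:
  fixes M :: "'a measure" and X :: "nat \<Rightarrow> nat \<Rightarrow> 'a \<Rightarrow> real"
    and q :: real and \<beta> \<xi> b c :: "nat \<Rightarrow> real"
  assumes "prob_space M"
    and "\<And>n k. 1 \<le> k \<Longrightarrow> k \<le> n \<Longrightarrow> X n k \<in> borel_measurable M"
    and "\<And>n k. 1 \<le> k \<Longrightarrow> k \<le> n \<Longrightarrow> integrable M (\<lambda>\<omega>. \<bar>X n k \<omega>\<bar>)"
    and "q > 2"
    and "\<And>n. n \<ge> 1 \<Longrightarrow> \<beta> n > 0" and "\<And>n. n \<ge> 1 \<Longrightarrow> \<xi> n > 0"
    and "\<And>n t. n \<ge> 1 \<Longrightarrow> t > 0 \<Longrightarrow>
      (\<integral>\<omega>. \<bar>\<Sum>k=1..n. trunc t (X n k \<omega>) - (\<integral>\<omega>'. trunc t (X n k \<omega>') \<partial>M)\<bar> powr q \<partial>M)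
        \<le> \<beta> n * (\<Sum>k=1..n. \<integral>\<omega>. \<bar>trunc t (X n k \<omega>)\<bar> powr q \<partial>M)
          + \<xi> n * (\<Sum>k=1..n. \<integral>\<omega>. \<bar>trunc t (X n k \<omega>)\<bar>\<^sup>2 \<partial>M) powr (q / 2)"
    and "\<And>n. n \<ge> 1 \<Longrightarrow> b n > 0" and "\<And>n. n \<ge> 1 \<Longrightarrow> c n > 0"
    and a: "(\<Sum>\<^sub>\<infinity>n\<in>{1..}. \<Sum>k=1..n. ennreal (\<beta> n * c n * b n powr (- q)) *
      (\<integral>\<^sup>+t\<in>{0..b n powr q}. ennreal \<P>(\<omega> in M. \<bar>X n k \<omega>\<bar> powr q > t) \<partial>lborel)) < \<infinity>"
    and b: "(\<Sum>\<^sub>\<infinity>n\<in>{1..}. ennreal (\<xi> n * c n / b n) *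
      (\<integral>\<^sup>+t\<in>{0..b n powr (1 - q)}.
        ennreal ((\<Sum>k=1..n. LINT s:{0..t powr (2 / (1 - q))}|lborel. \<P>(\<omega> in M. (X n k \<omega>)\<^sup>2 > s)) powr (q / 2))
        \<partial>lborel)) < \<infinity>"
    and c: "(\<Sum>\<^sub>\<infinity>n\<in>{1..}. ennreal (\<xi> n * c n * b n powr (- q) *
      (\<Sum>k=1..n. LINT t:{0..(b n)\<^sup>2}|lborel. \<P>(\<omega> in M. (X n k \<omega>)\<^sup>2 > t)) powr (q / 2))) < \<infinity>"
    and d: "(\<Sum>\<^sub>\<infinity>n\<in>{1..}. \<Sum>k=1..n. ennreal (c n / b n) *
      (\<integral>\<^sup>+\<omega>. ennreal (\<bar>X n k \<omega>\<bar> * indicator {\<omega>. \<bar>X n k \<omega>\<bar> > b n} \<omega>) \<partial>M)) < \<infinity>"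
    and e: "(\<Sum>\<^sub>\<infinity>n\<in>{1..}. \<Sum>k=1..n. ennreal (\<beta> n * c n / b n) *
      (\<integral>\<^sup>+t\<in>{b n..}. ennreal \<P>(\<omega> in M. \<bar>X n k \<omega>\<bar> > t) \<partial>lborel)) < \<infinity>"
  shows "\<forall>\<epsilon>>0. (\<Sum>\<^sub>\<infinity>n\<in>{1..}. ennreal (c n) *
      (\<integral>\<^sup>+\<omega>. ennreal (pos_part (\<bar>\<Sum>k=1..n. X n k \<omega> - (\<integral>\<omega>'. X n k \<omega>' \<partial>M)\<bar> / b n - \<epsilon>)) \<partial>M)) < \<infinity>"
proof (intro allI impI)
  fix \<epsilon> :: real assume \<epsilon>: "0 < \<epsilon>"
  interpret prob_space M by fact
  define T where "T n = ennreal (c n) * (\<integral>\<^sup>+\<omega>. ennreal (pos_part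
    (\<bar>\<Sum>k=1..n. X n k \<omega> - (\<integral>\<omega>'. X n k \<omega>' \<partial>M)\<bar> / b n - \<epsilon>)) \<partial>M)" for n
  define A where "A n = (\<Sum>k=1..n. ennreal (\<beta> n * c n * b n powr (- q)) *
      (\<integral>\<^sup>+t\<in>{0..b n powr q}. ennreal \<P>(\<omega> in M. \<bar>X n k \<omega>\<bar> powr q > t) \<partial>lborel))" for n
  define C where "C n = ennreal (\<xi> n * c n * b n powr (- q) *
      (\<Sum>k=1..n. LINT t:{0..(b n)\<^sup>2}|lborel. \<P>(\<omega> in M. (X n k \<omega>)\<^sup>2 > t)) powr (q / 2))" for n
  define D where "D n = (\<Sum>k=1..n. ennreal (c n / b n) *
      (\<integral>\<^sup>+\<omega>. ennreal (\<bar>X n k \<omega>\<bar> * indicator {\<omega>. \<bar>X n k \<omega>\<bar> > b n} \<omega>) \<partial>M))" for n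
  \<comment> \<open>Only the part of the constant that is independent of \<open>n\<close> is kept,
    so that it can be pulled out of the series; \<open>b n powr (- q)\<close> is absorbed into
    \<open>A n\<close> and \<open>C n\<close>.\<close>
  define K where "K = \<epsilon> powr (1 - q)"
  \<comment> \<open>The row estimate at level \<open>u = b n\<close>, multiplied by
    \<open>c n\<close>: its right-hand side consists of the terms of the series in (a), (c) and
    (d).\<close>
  have bound: "T n \<le> ennreal K * (A n + C n) + 2 * D n" if n: "1 \<le> n" for n
  proof -
    note pos = assms(4) assms(5,6,8,9)[OF n]
    define mq where "mq k = expectation (\<lambda>\<omega>. \<bar>trunc (b n) (X n k \<omega>)\<bar> powr q)" for k
    define m2 where "m2 k = expectation (\<lambda>\<omega>. \<bar>trunc (b n) (X n k \<omega>)\<bar>\<^sup>2)" for k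
    define E where "E = expectation (\<lambda>\<omega>. \<bar>\<Sum>k=1..n. trunc (b n) (X n k \<omega>)
      - (\<integral>\<omega>'. trunc (b n) (X n k \<omega>') \<partial>M)\<bar> powr q)"
    define J where "J k = (\<integral>\<^sup>+\<omega>. ennreal (\<bar>X n k \<omega>\<bar> * indicator {\<omega>. \<bar>X n k \<omega>\<bar> > b n} \<omega>) \<partial>M)" for k
    have mq: "ennreal (mq k)
        = (\<integral>\<^sup>+t\<in>{0..b n powr q}. ennreal \<P>(\<omega> in M. \<bar>X n k \<omega>\<bar> powr q > t) \<partial>lborel)"
      and m2: "m2 k = (LINT t:{0..(b n)\<^sup>2}|lborel. \<P>(\<omega> in M. (X n k \<omega>)\<^sup>2 > t))"
      if "k \<in> {1..n}" for k
    proof -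
      have [measurable]: "X n k \<in> borel_measurable M"
        using assms(2) that by simp
      show "ennreal (mq k)
        = (\<integral>\<^sup>+t\<in>{0..b n powr q}. ennreal \<P>(\<omega> in M. \<bar>X n k \<omega>\<bar> powr q > t) \<partial>lborel)"
        using pos unfolding mq_def by (simp add: abs_trunc_powr expectation_min_eq_tail(1))
      show "m2 k = (LINT t:{0..(b n)\<^sup>2}|lborel. \<P>(\<omega> in M. (X n k \<omega>)\<^sup>2 > t))"
        using pos unfolding m2_def by (simp only: abs_trunc_power2) (simp add: expectation_min_eq_tail(2))
    qed
    have mq0: "0 \<le> mq k" for k
      by (simp add: mq_def)
    have A: "A n = ennreal (\<beta> n * c n * b n powr (- q) * (\<Sum>k=1..n. mq k))"
      using pos mq0 by (simp add: A_def mq[symmetric] sum_distrib_left[symmetric] sum_nonneg ennreal_mult)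
    have C: "C n = ennreal (\<xi> n * c n * b n powr (- q) * (\<Sum>k=1..n. m2 k) powr (q / 2))"
      by (simp add: C_def m2)
    have D: "D n = ennreal (c n) * (\<Sum>k=1..n. ennreal (1 / b n) * J k)"
      using pos unfolding D_def J_def sum_distrib_left mult.assoc[symmetric]
      by (simp add: ennreal_mult[symmetric])
    have "T n \<le> ennreal (c n) * (ennreal (\<epsilon> powr (1 - q) * b n powr (- q) * E)
        + 2 * (\<Sum>k=1..n. ennreal (1 / b n) * J k))"
      unfolding T_def E_def J_def using pos \<epsilon> assms(2,3)
      by (intro mult_left_mono expectation_pos_part_sum_le) (auto simp: integrable_abs_iff)
    also have "\<dots> = ennreal (c n * (K * b n powr (- q) * E)) + 2 * D n"
      using pos by (simp add: D K_def distrib_left ennreal_mult' mult.left_commute)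
    \<comment> \<open>The moment hypothesis enters here, at \<open>t = b n\<close>.\<close>
    also have "c n * (K * b n powr (- q) * E)
        \<le> c n * (K * b n powr (- q) * (\<beta> n * (\<Sum>k=1..n. mq k) + \<xi> n * (\<Sum>k=1..n. m2 k) powr (q / 2)))"
      unfolding E_def mq_def m2_def using pos
      by (intro mult_left_mono assms(7) n) (auto simp: K_def)
    also have "\<dots> = K * (\<beta> n * c n * b n powr (- q) * (\<Sum>k=1..n. mq k)
        + \<xi> n * c n * b n powr (- q) * (\<Sum>k=1..n. m2 k) powr (q / 2))"
      by (simp add: algebra_simps)
    also have "ennreal \<dots> = ennreal K * (A n + C n)"
      using pos mq0 by (simp add: A C K_def ennreal_mult sum_nonneg)
    finally show ?thesis
      by (simp add: ennreal_leI)
  qed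
  \<comment> \<open>Every family in \<open>ennreal\<close> is summable, so the row bounds can be
    summed and the sum split before finiteness is known.\<close>
  have "infsum T {1..} \<le> (\<Sum>\<^sub>\<infinity>n\<in>{1..}. ennreal K * (A n + C n) + 2 * D n)"
    using bound by (intro infsum_mono nonneg_summable_on_complete) auto
  also have "\<dots> = ennreal K * (infsum A {1..} + infsum C {1..}) + 2 * infsum D {1..}"
    by (simp add: infsum_add infsum_cmult_ennreal nonneg_summable_on_complete)
  also have "\<dots> < \<infinity>"
  proof -
    have "infsum A {1..} < \<infinity>" "infsum C {1..} < \<infinity>" "infsum D {1..} < \<infinity>"
      using a c d unfolding A_def C_def D_def by blast+
    then show ?thesis
      by (simp add: ennreal_mult_less_top)
  qed
  finally show "(\<Sum>\<^sub>\<infinity>n\<in>{1..}. ennreal (c n) * (\<integral>\<^sup>+\<omega>. ennreal (pos_part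
      (\<bar>\<Sum>k=1..n. X n k \<omega> - (\<integral>\<omega>'. X n k \<omega>' \<partial>M)\<bar> / b n - \<epsilon>)) \<partial>M)) < \<infinity>"
    unfolding T_def .
qed

end
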